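(* Let $(V,\Phi)$ be the following $\ell$EAS: $V$ is two-dimensional, with basis $(e_1,e_2)$, and the matrix of $\Phi$ in the basis $(e_1\otimes e_1,e_1\otimes e_2,e_2\otimes e_1,e_2\otimes e_2)$ is $$\begin{pmatrix}1&0&0&0\\1&0&0&0\\0&1&0&0\\0&0&0&1\end{pmatrix}.$$ Then any opposite $\Phi$-associative algebra $A$ is a post-Lie algebra, with, for any $x,y\in A$, $$\{x,y\}=x*_2y-y*_2x,\qquad x*y=x*_1y,$$ where $*_i=*_{e_i}$ for $i=1,2$.
   Context: All vector spaces are over a field $\mathbb{K}$. The columns of the matrix are the images of the basis vectors, i.e. $\Phi(e_1\otimes e_1)=e_1\otimes e_1+e_1\otimes e_2$, $\Phi(e_1\otimes e_2)=e_2\otimes e_1$, $\Phi(e_2\otimes e_1)=0$, $\Phi(e_2\otimes e_2)=e_2\otimes e_2$. $(V,\Phi)$ is an $\ell$EAS if $(\mathrm{Id}\otimes\Phi)\circ(\Phi\otimes\mathrm{Id})\circ(\mathrm{Id}\otimes\Phi)=(\Phi\otimes\mathrm{Id})\circ(\mathrm{Id}\otimes\tau)\circ(\Phi\otimes\mathrm{Id})$ on $V^{\otimes 3}$, with $\tau(a\otimes b)=b\otimes a$. Writing $\Phi(a\otimes b)=\sum a'\rightarrow b'\otimes a''\triangleright b''$ symbolically, an opposite $\Phi$-associative algebra is a vector space $A$ with bilinear products $*_a$, linear in $a\in V$, such that $\sum x*_{a'\rightarrow b'}(y*_{a''\triangleright b''}z)=(x*_by)*_az$ for all $x,y,z\in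 A$, $a,b\in V$. A post-Lie algebra is $(A,*,\{,\})$ where $(A,\{,\})$ is a Lie algebra and $*$ is a bilinear product such that for all $x,y,z\in A$: $x*\{y,z\}=(x*y)*z-x*(y*z)-(x*z)*y+x*(z*y)$ and $\{x,y\}*z=\{x*z,y\}+\{x,y*z\}$. *)

theory Defs
  imports Complex_Main
begin

section \<open>Tensor products of vector spaces\<close>

text \<open>Vector spaces over a field \<open>'k\<close> are given, as in the theory \<^theory>\<open>HOL.Vector_Spaces\<close>, by a
  scalar multiplication on an abelian group type.\<close>

definition bilinear_map ::
  "('k::field \<Rightarrow> 'v::ab_group_add \<Rightarrow> 'v) \<Rightarrow> ('k \<Rightarrow> 'w::ab_group_add \<Rightarrow> 'w) \<Rightarrow>
   ('k \<Rightarrow> 'u::ab_group_add \<Rightarrow> 'u) \<Rightarrow> ('v \<Rightarrow> 'w \<Rightarrow> 'u) \<Rightarrow> bool" where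
  "bilinear_map sV sW sU b \<longleftrightarrow>
     (\<forall>v. Vector_Spaces.linear sW sU (b v)) \<and> (\<forall>w. Vector_Spaces.linear sV sU (\<lambda>v. b v w))"

text \<open>\<open>T\<close> with the bilinear map \<open>t\<close> is a tensor product of \<open>V\<close> and \<open>W\<close>. A HOL formula cannot
  quantify over the target spaces of the universal property, so it is required for the target
  \<open>'k\<close> only. Over a field this implies the universal property for all targets, see
  \<open>tensor_product_universal\<close> below.\<close>

definition tensor_product ::
  "('k::field \<Rightarrow> 'v::ab_group_add \<Rightarrow> 'v) \<Rightarrow> ('k \<Rightarrow> 'w::ab_group_add \<Rightarrow> 'w) \<Rightarrow>
   ('k \<Rightarrow> 't::ab_group_add \<Rightarrow> 't) \<Rightarrow> ('v \<Rightarrow> 'w \<Rightarrow> 't) \<Rightarrow> bool" where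
  "tensor_product sV sW sT t \<longleftrightarrow>
     bilinear_map sV sW sT t \<and>
     (\<forall>b. bilinear_map sV sW ((*) :: 'k \<Rightarrow> 'k \<Rightarrow> 'k) b \<longrightarrow>
        (\<exists>!f. Vector_Spaces.linear sT (*) f \<and> (\<forall>v w. f (t v w) = b v w)))"

lemma vector_space_field: "vector_space ((*) :: 'k::field \<Rightarrow> 'k \<Rightarrow> 'k)"
  by unfold_locales (auto simp: algebra_simps)

lemma bilinear_mapI:
  assumes "vector_space sV" "vector_space sW" "vector_space sU"
    and "\<And>v w w'. b v (w + w') = b v w + b v w'" and "\<And>v c w. b v (sW c w) = sU c (b v w)"
    and "\<And>v v' w. b (v + v') w = b v w + b v' w" and "\<And>c v w. b (sV c v) w = sU c (b v w)"
  shows "bilinear_map sV sW sU b"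
  using assms by (simp add: bilinear_map_def Vector_Spaces.linear_iff)

lemma bilinear_mapD:
  assumes "bilinear_map sV sW sU b"
  shows "b v (w + w') = b v w + b v w'" and "b v (sW c w) = sU c (b v w)"
    and "b (v + v') w = b v w + b v' w" and "b (sV c v) w = sU c (b v w)"
  using assms by (simp_all add: bilinear_map_def Vector_Spaces.linear_iff)

lemma bilinear_map_vector_spaces:
  assumes "bilinear_map sV sW sU b"
  shows "vector_space sV" "vector_space sW" "vector_space sU"
  using assms unfolding bilinear_map_def Vector_Spaces.linear_def by auto

lemma tensor_product_span:
  assumes T: "tensor_product sV sW sT t"
  shows "module.span sT {t v w |v w. True} = UNIV"
proof (rule ccontr)
  let ?S = "{t v w |v w. True}"
  have bt: "bilinear_map sV sW sT t" using T by (simp add: tensor_product_def)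
  interpret vT: vector_space sT by (rule bilinear_map_vector_spaces(3)[OF bt])
  interpret p: vector_space_pair sT "(*)"
    unfolding vector_space_pair_def using vector_space_field vT.vector_space_axioms by blast
  assume "vT.span ?S \<noteq> UNIV"
  then obtain x where x: "x \<notin> vT.span ?S" by blast
  obtain B where B: "B \<subseteq> ?S" "vT.independent B" "?S \<subseteq> vT.span B"
    by (meson vT.maximal_independent_subset)
  have "x \<notin> vT.span B" using x B(1) vT.span_mono by blast
  then have "vT.independent (insert x B)" using B(2) by (rule vT.independent_insertI)
  then obtain f where f: "Vector_Spaces.linear sT (*) f"
      "\<forall>y\<in>insert x B. f y = (if y = x then 1 else 0)"
    using p.linear_independent_extend[of "insert x B" "\<lambda>y. if y = x then 1 else 0"] by blast
  have f0: "f y = 0" if "y \<in> vT.span B" for y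
  proof (rule p.linear_eq_0_on_span[OF f(1) _ that])
    show "f z = 0" if "z \<in> B" for z
      using that f(2) \<open>x \<notin> vT.span B\<close> vT.span_base by fastforce
  qed
  have zero: "Vector_Spaces.linear sT (*) (\<lambda>_. 0)" by (rule p.linear_zero)
  have "bilinear_map sV sW (*) (\<lambda>_ _. 0::'a)"
    by (rule bilinear_mapI[OF bilinear_map_vector_spaces(1,2)[OF bt] vector_space_field]) simp_all
  then have "\<exists>!f. Vector_Spaces.linear sT (*) f \<and> (\<forall>v w. f (t v w) = 0)"
    using T by (simp add: tensor_product_def)
  moreover have "\<forall>v w. f (t v w) = 0" using f0 B(3) by blast
  ultimately have "f = (\<lambda>_. 0)" using f(1) zero by blast
  then show False using f(2) by simp
qed

theorem tensor_product_universal: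
  assumes T: "tensor_product sV sW sT t" and b: "bilinear_map sV sW sU b"
  shows "\<exists>!f. Vector_Spaces.linear sT sU f \<and> (\<forall>v w. f (t v w) = b v w)"
proof -
  have bt: "bilinear_map sV sW sT t" using T by (simp add: tensor_product_def)
  interpret vV: vector_space sV by (rule bilinear_map_vector_spaces(1)[OF bt])
  interpret vW: vector_space sW by (rule bilinear_map_vector_spaces(2)[OF bt])
  interpret vT: vector_space sT by (rule bilinear_map_vector_spaces(3)[OF bt])
  interpret vU: vector_space sU by (rule bilinear_map_vector_spaces(3)[OF b])
  interpret TU: vector_space_pair sT sU ..
  interpret VU: vector_space_pair sV sU ..
  interpret WU: vector_space_pair sW sU ..
  interpret VK: vector_space_pair sV "(*)"
    unfolding vector_space_pair_def using vector_space_field vV.vector_space_axioms by blast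
  interpret WK: vector_space_pair sW "(*)"
    unfolding vector_space_pair_def using vector_space_field vW.vector_space_axioms by blast
  interpret TK: vector_space_pair sT "(*)"
    unfolding vector_space_pair_def using vector_space_field vT.vector_space_axioms by blast
  obtain B where B: "vV.independent B" "vV.span B = UNIV"
    using vV.maximal_independent_subset[of UNIV] by (metis top.extremum_uniqueI)
  obtain C where C: "vW.independent C" "vW.span C = UNIV"
    using vW.maximal_independent_subset[of UNIV] by (metis top.extremum_uniqueI)
  define tt where "tt = (\<lambda>(v, w). t v w)"
  let ?D = "tt ` (B \<times> C)"
  have dual: "\<exists>f. Vector_Spaces.linear sT (*) f \<and>
       (\<forall>q\<in>B \<times> C. f (tt q) = (if q = p then 1 else 0))" if p: "p \<in> B \<times> C" for p
  proof -
    obtain g where g: "Vector_Spaces.linear sV (*) g" "\<forall>y\<in>B. g y = (if y = fst p then 1 else 0)"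
      using VK.linear_independent_extend[OF B(1), of "\<lambda>y. if y = fst p then 1 else 0"] by blast
    obtain h where h: "Vector_Spaces.linear sW (*) h" "\<forall>y\<in>C. h y = (if y = snd p then 1 else 0)"
      using WK.linear_independent_extend[OF C(1), of "\<lambda>y. if y = snd p then 1 else 0"] by blast
    have "bilinear_map sV sW (*) (\<lambda>v w. g v * h w)"
      using g(1) h(1) unfolding Vector_Spaces.linear_iff
      by (intro bilinear_mapI vector_space_field) (simp_all add: distrib_left distrib_right mult.left_commute)
    then obtain f where f: "Vector_Spaces.linear sT (*) f" "\<forall>v w. f (t v w) = g v * h w"
      using T unfolding tensor_product_def by metis
    then show ?thesis using g(2) h(2) by (intro exI[of _ f]) (auto simp: tt_def prod_eq_iff)
  qed
  have inj: "inj_on tt (B \<times> C)"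
  proof (rule inj_onI)
    fix p q assume "p \<in> B \<times> C" "q \<in> B \<times> C" "tt p = tt q"
    then show "p = q" using dual[of p] by (metis zero_neq_one)
  qed
  have indep: "vT.independent ?D"
  proof
    assume "vT.dependent ?D"
    then obtain p where p: "p \<in> B \<times> C" "tt p \<in> vT.span (?D - {tt p})"
      unfolding vT.dependent_def by blast
    obtain f where f: "Vector_Spaces.linear sT (*) f"
        "\<forall>q\<in>B \<times> C. f (tt q) = (if q = p then 1 else 0)"
      using dual[OF p(1)] by blast
    have "f (tt p) = 0"
      by (rule TK.linear_eq_0_on_span[OF f(1) _ p(2)]) (use f(2) in auto)
    then show False using f(2) p(1) by simp
  qed
  have ex: "\<exists>f. Vector_Spaces.linear sT sU f \<and> (\<forall>v w. f (t v w) = b v w)"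
  proof -
    obtain f where f: "Vector_Spaces.linear sT sU f"
        "\<forall>y\<in>?D. f y = (\<lambda>(v, w). b v w) (inv_into (B \<times> C) tt y)"
      using TU.linear_independent_extend[OF indep, of "\<lambda>y. (\<lambda>(v, w). b v w) (inv_into (B \<times> C) tt y)"]
      by blast
    have bc: "f (t v w) = b v w" if "v \<in> B" "w \<in> C" for v w
    proof -
      have "inv_into (B \<times> C) tt (tt (v, w)) = (v, w)"
        using inj that by (intro inv_into_f_f) auto
      then show ?thesis using f(2) that by (auto simp: tt_def)
    qed
    have lw: "Vector_Spaces.linear sW sU (\<lambda>w. f (t v w))" "Vector_Spaces.linear sW sU (b v)" for v
      using b Vector_Spaces.linear_compose[OF _ f(1), of sW "t v"] bt
      by (simp_all add: bilinear_map_def comp_def)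
    have lv: "Vector_Spaces.linear sV sU (\<lambda>v. f (t v w))" "Vector_Spaces.linear sV sU (\<lambda>v. b v w)" for w
      using b Vector_Spaces.linear_compose[OF _ f(1), of sV "\<lambda>v. t v w"] bt
      by (simp_all add: bilinear_map_def comp_def)
    have 1: "f (t v w) = b v w" if "v \<in> B" for v w
      by (rule WU.linear_eq_on[OF lw, of w C]) (use C bc that in auto)
    have "f (t v w) = b v w" for v w
      by (rule VU.linear_eq_on[OF lv, of v B]) (use B 1 in auto)
    then show ?thesis using f(1) by blast
  qed
  show ?thesis
  proof (rule ex_ex1I[OF ex])
    fix f g
    assume fg: "Vector_Spaces.linear sT sU f \<and> (\<forall>v w. f (t v w) = b v w)"
      "Vector_Spaces.linear sT sU g \<and> (\<forall>v w. g (t v w) = b v w)"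
    have "f x = g x" for x
      by (rule TU.linear_eq_on[of f g x "{t v w |v w. True}"])
        (use fg tensor_product_span[OF T] in auto)
    then show "f = g" by blast
  qed
qed

definition tensor_lift ::
  "('k::field \<Rightarrow> 't::ab_group_add \<Rightarrow> 't) \<Rightarrow> ('k \<Rightarrow> 'u::ab_group_add \<Rightarrow> 'u) \<Rightarrow>
   ('v \<Rightarrow> 'w \<Rightarrow> 't) \<Rightarrow> ('v \<Rightarrow> 'w \<Rightarrow> 'u) \<Rightarrow> 't \<Rightarrow> 'u" where
  "tensor_lift sT sU t b = (THE f. Vector_Spaces.linear sT sU f \<and> (\<forall>v w. f (t v w) = b v w))"

lemma tensor_lift:
  assumes "tensor_product sV sW sT t" and "bilinear_map sV sW sU b"
  shows "Vector_Spaces.linear sT sU (tensor_lift sT sU t b)"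
    and "tensor_lift sT sU t b (t v w) = b v w"
  using theI'[OF tensor_product_universal[OF assms]] unfolding tensor_lift_def by auto

text \<open>\<open>f \<otimes> g\<close> as an endomorphism of the tensor product \<open>(T, t)\<close>.\<close>

definition tensor_map ::
  "('k::field \<Rightarrow> 't::ab_group_add \<Rightarrow> 't) \<Rightarrow> ('v \<Rightarrow> 'w \<Rightarrow> 't) \<Rightarrow>
   ('v \<Rightarrow> 'v) \<Rightarrow> ('w \<Rightarrow> 'w) \<Rightarrow> 't \<Rightarrow> 't" where
  "tensor_map sT t f g = tensor_lift sT sT t (\<lambda>v w. t (f v) (g w))"

definition tensor_flip ::
  "('k::field \<Rightarrow> 't::ab_group_add \<Rightarrow> 't) \<Rightarrow> ('v \<Rightarrow> 'v \<Rightarrow> 't) \<Rightarrow> 't \<Rightarrow> 't" where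
  "tensor_flip sT t = tensor_lift sT sT t (\<lambda>a b. t b a)"

text \<open>\<open>(T2, t)\<close> is \<open>V \<otimes> V\<close> and \<open>T3\<close> is \<open>V \<otimes> V \<otimes> V\<close>, seen as \<open>V \<otimes> (V \<otimes> V)\<close> through \<open>l\<close> and
  as \<open>(V \<otimes> V) \<otimes> V\<close> through \<open>r\<close>; the last condition is the usual identification of the two.\<close>

definition tensor_powers ::
  "('k::field \<Rightarrow> 'v::ab_group_add \<Rightarrow> 'v) \<Rightarrow> ('k \<Rightarrow> 't2::ab_group_add \<Rightarrow> 't2) \<Rightarrow>
   ('k \<Rightarrow> 't3::ab_group_add \<Rightarrow> 't3) \<Rightarrow> ('v \<Rightarrow> 'v \<Rightarrow> 't2) \<Rightarrow> ('v \<Rightarrow> 't2 \<Rightarrow> 't3) \<Rightarrow> ('t2 \<Rightarrow> 'v \<Rightarrow> 't3) \<Rightarrow> bool"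
  where
  "tensor_powers sV sT2 sT3 t l r \<longleftrightarrow>
     tensor_product sV sV sT2 t \<and> tensor_product sV sT2 sT3 l \<and> tensor_product sT2 sV sT3 r \<and>
     (\<forall>a b c. r (t a b) c = l a (t b c))"

section \<open>Linear extended associative semigroups and their algebras\<close>

definition lEAS ::
  "('k::field \<Rightarrow> 't2::ab_group_add \<Rightarrow> 't2) \<Rightarrow> ('k \<Rightarrow> 't3::ab_group_add \<Rightarrow> 't3) \<Rightarrow>
   ('v \<Rightarrow> 'v \<Rightarrow> 't2) \<Rightarrow> ('v \<Rightarrow> 't2 \<Rightarrow> 't3) \<Rightarrow> ('t2 \<Rightarrow> 'v \<Rightarrow> 't3) \<Rightarrow> ('t2 \<Rightarrow> 't2) \<Rightarrow> bool" where
  "lEAS sT2 sT3 t l r \<Phi> \<longleftrightarrow>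
     Vector_Spaces.linear sT2 sT2 \<Phi> \<and>
     tensor_map sT3 l id \<Phi> \<circ> tensor_map sT3 r \<Phi> id \<circ> tensor_map sT3 l id \<Phi> =
     tensor_map sT3 r \<Phi> id \<circ> tensor_map sT3 l id (tensor_flip sT2 t) \<circ> tensor_map sT3 r \<Phi> id"

text \<open>\<open>m a x y\<close> is the product of \<open>x\<close> and \<open>y\<close> indexed by \<open>a\<close>. The symbolic sum in the axiom is the
  value at \<open>\<Phi> (a \<otimes> b)\<close> of the linear map sending \<open>c \<otimes> d\<close> to \<open>m c x (m d y z)\<close>.\<close>

definition opposite_assoc_algebra ::
  "('k::field \<Rightarrow> 'v::ab_group_add \<Rightarrow> 'v) \<Rightarrow> ('k \<Rightarrow> 't2::ab_group_add \<Rightarrow> 't2) \<Rightarrow> ('v \<Rightarrow> 'v \<Rightarrow> 't2) \<Rightarrow>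
   ('t2 \<Rightarrow> 't2) \<Rightarrow> ('k \<Rightarrow> 'a::ab_group_add \<Rightarrow> 'a) \<Rightarrow> ('v \<Rightarrow> 'a \<Rightarrow> 'a \<Rightarrow> 'a) \<Rightarrow> bool" where
  "opposite_assoc_algebra sV sT2 t \<Phi> sA m \<longleftrightarrow>
     (\<forall>a. bilinear_map sA sA sA (m a)) \<and>
     (\<forall>x y. Vector_Spaces.linear sV sA (\<lambda>a. m a x y)) \<and>
     (\<forall>a b x y z.
        tensor_lift sT2 sA t (\<lambda>c d. m c x (m d y z)) (\<Phi> (t a b)) = m a (m b x y) z)"

lemma bilinear_map_opposite_product:
  assumes "\<And>a. bilinear_map sA sA sA (m a)" and "\<And>x y. Vector_Spaces.linear sV sA (\<lambda>a. m a x y)"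
  shows "bilinear_map sV sV sA (\<lambda>c d. m c x (m d y z))"
proof (rule bilinear_mapI)
  show "vector_space sV" "vector_space sA"
    using assms(2) by (simp_all add: Vector_Spaces.linear_iff)
  then show "vector_space sV" by simp
qed (use assms(2) in \<open>simp_all add: Vector_Spaces.linear_iff bilinear_mapD[OF assms(1)]\<close>)

section \<open>Post-Lie algebras\<close>

definition lie_algebra ::
  "('k::field \<Rightarrow> 'a::ab_group_add \<Rightarrow> 'a) \<Rightarrow> ('a \<Rightarrow> 'a \<Rightarrow> 'a) \<Rightarrow> bool" where
  "lie_algebra sA br \<longleftrightarrow>
     bilinear_map sA sA sA br \<and> (\<forall>x. br x x = 0) \<and>
     (\<forall>x y z. br x (br y z) + br y (br z x) + br z (br x y) = 0)"

definition post_lie_algebra ::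
  "('k::field \<Rightarrow> 'a::ab_group_add \<Rightarrow> 'a) \<Rightarrow> ('a \<Rightarrow> 'a \<Rightarrow> 'a) \<Rightarrow> ('a \<Rightarrow> 'a \<Rightarrow> 'a) \<Rightarrow> bool" where
  "post_lie_algebra sA p br \<longleftrightarrow>
     lie_algebra sA br \<and> bilinear_map sA sA sA p \<and>
     (\<forall>x y z. p x (br y z) = p (p x y) z - p x (p y z) - p (p x z) y + p x (p z y)) \<and>
     (\<forall>x y z. p (br x y) z = br (p x z) y + br x (p y z))"

end

(* The lEAS identity is checked on the eight words e_i \<otimes> e_j \<otimes> e_k, which span the triple tensor
   power. Writing \<circ> and \<cdot> for the products indexed by e1 and e2, the axiom of an opposite
   algebra at the four pairs of basis vectors reads (x\<circ>y)\<circ>z = x\<circ>(y\<circ>z) + x\<circ>(y\<cdot>z),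
   (x\<cdot>y)\<circ>z = x\<cdot>(y\<circ>z), (x\<circ>y)\<cdot>z = 0 and (x\<cdot>y)\<cdot>z = x\<cdot>(y\<cdot>z). The last makes the commutator of
   \<cdot> a Lie bracket; antisymmetrising the first in y, z gives the first post-Lie identity, and the
   second one is the second relation, with the remaining terms of the form (x\<circ>z)\<cdot>y killed by
   the third. *)

theory Submission
  imports Defs
begin

text \<open>Linearity of \<open>f\<close> and \<open>g\<close> makes \<open>t (f v) (g w)\<close>
  bilinear in \<open>v\<close> and \<open>w\<close>. The universal property then guarantees that the
  definite description behind \<open>tensor_map\<close> denotes a map.\<close>

lemma tensor_map:
  assumes "tensor_product sV sW sT t"
    and "Vector_Spaces.linear sV sV f" and "Vector_Spaces.linear sW sW g"
  shows "Vector_Spaces.linear sT sT (tensor_map sT t f g)"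
    and "tensor_map sT t f g (t v w) = t (f v) (g w)"
proof -
  have t: "bilinear_map sV sW sT t"
    using assms(1) by (simp add: tensor_product_def)
  have "bilinear_map sV sW sT (\<lambda>v w. t (f v) (g w))"
    using assms(2,3) unfolding Vector_Spaces.linear_iff
    by (intro bilinear_mapI bilinear_map_vector_spaces[OF t]) (simp_all add: bilinear_mapD[OF t])
  from tensor_lift[OF assms(1) this]
  show "Vector_Spaces.linear sT sT (tensor_map sT t f g)"
    and "tensor_map sT t f g (t v w) = t (f v) (g w)"
    by (simp_all add: tensor_map_def)
qed

lemma tensor_flip:
  assumes "tensor_product sV sV sT t"
  shows "Vector_Spaces.linear sT sT (tensor_flip sT t)"
    and "tensor_flip sT t (t a b) = t b a"
proof -
  have t: "bilinear_map sV sV sT t"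
    using assms by (simp add: tensor_product_def)
  have "bilinear_map sV sV sT (\<lambda>a b. t b a)"
    by (intro bilinear_mapI bilinear_map_vector_spaces[OF t]) (simp_all add: bilinear_mapD[OF t])
  from tensor_lift[OF assms this]
  show "Vector_Spaces.linear sT sT (tensor_flip sT t)" and "tensor_flip sT t (t a b) = t b a"
    by (simp_all add: tensor_flip_def)
qed

text \<open>Expand one argument at a time, the second with the first held in \<open>B\<close>, then
  the first with the second arbitrary. Applied twice, this reduces an identity on the triple tensor
  power to words in \<open>e1\<close> and \<open>e2\<close>.\<close>

lemma tensor_product_span_generators:
  assumes T: "tensor_product sV sW sT t"
    and B: "module.span sV B = UNIV" and C: "module.span sW C = UNIV"
  shows "module.span sT {t v w |v w. v \<in> B \<and> w \<in> C} = UNIV"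
proof -
  have t: "bilinear_map sV sW sT t"
    using T by (simp add: tensor_product_def)
  interpret V: vector_space sV by (rule bilinear_map_vector_spaces(1)[OF t])
  interpret W: vector_space sW by (rule bilinear_map_vector_spaces(2)[OF t])
  interpret T: vector_space sT by (rule bilinear_map_vector_spaces(3)[OF t])
  interpret VT: vector_space_pair sV sT ..
  interpret WT: vector_space_pair sW sT ..
  let ?S = "{t v w |v w. v \<in> B \<and> w \<in> C}"
  have W_step: "t v w \<in> T.span ?S" if "v \<in> B" for v w
  proof -
    have "w \<in> W.span C" using C by simp
    then show ?thesis
    proof (induction rule: W.span_induct_alt)
      case base
      have "t v 0 = 0"
        using bilinear_mapD(1)[OF t, of v 0 0] by simp
      then show ?case by (simp add: T.span_zero)
    next
      case (step c x y)
      have "t v x \<in> T.span ?S" using step that by (intro T.span_base) blast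
      then show ?case
        using step by (simp add: bilinear_mapD[OF t] T.span_add T.span_scale)
    qed
  qed
  have "t v w \<in> T.span ?S" for v w
  proof -
    have "v \<in> V.span B" using B by simp
    then show ?thesis
    proof (induction rule: V.span_induct_alt)
      case base
      have "t 0 w = 0"
        using bilinear_mapD(3)[OF t, of 0 0 w] by simp
      then show ?case by (simp add: T.span_zero)
    next
      case (step c x y)
      then show ?case
        using W_step by (simp add: bilinear_mapD[OF t] T.span_add T.span_scale)
    qed
  qed
  then have "T.span {t v w |v w. True} \<subseteq> T.span ?S"
    by (intro T.span_minimal T.subspace_span) blast
  then show ?thesis using tensor_product_span[OF T] by blast
qed

theorem corollary4p3:
  fixes sV :: "'k::field \<Rightarrow> 'v::ab_group_add \<Rightarrow> 'v"
    and sT2 :: "'k \<Rightarrow> 't2::ab_group_add \<Rightarrow> 't2"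
    and sT3 :: "'k \<Rightarrow> 't3::ab_group_add \<Rightarrow> 't3"
    and t :: "'v \<Rightarrow> 'v \<Rightarrow> 't2"
    and l :: "'v \<Rightarrow> 't2 \<Rightarrow> 't3"
    and r :: "'t2 \<Rightarrow> 'v \<Rightarrow> 't3"
    and \<Phi> :: "'t2 \<Rightarrow> 't2"
    and e1 e2 :: 'v
  assumes "vector_space sV"
    and "tensor_powers sV sT2 sT3 t l r"
    and "e1 \<noteq> e2" and "\<not> module.dependent sV {e1, e2}" and "module.span sV {e1, e2} = UNIV"
    and "Vector_Spaces.linear sT2 sT2 \<Phi>"
    and "\<Phi> (t e1 e1) = t e1 e1 + t e1 e2"
    and "\<Phi> (t e1 e2) = t e2 e1"
    and "\<Phi> (t e2 e1) = 0"
    and "\<Phi> (t e2 e2) = t e2 e2"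
  shows "lEAS sT2 sT3 t l r \<Phi> \<and>
    (\<forall>(sA :: 'k \<Rightarrow> 'a::ab_group_add \<Rightarrow> 'a) m.
       opposite_assoc_algebra sV sT2 t \<Phi> sA m \<longrightarrow>
       post_lie_algebra sA (\<lambda>x y. m e1 x y) (\<lambda>x y. m e2 x y - m e2 y x))"
proof (intro conjI allI impI)
  have T2: "tensor_product sV sV sT2 t" and Tl: "tensor_product sV sT2 sT3 l"
    and Tr: "tensor_product sT2 sV sT3 r" and r: "r (t a b) c = l a (t b c)" for a b c
    using assms(2) by (auto simp: tensor_powers_def)
  have bl: "bilinear_map sV sT2 sT3 l" and br: "bilinear_map sT2 sV sT3 r"
    using Tl Tr by (simp_all add: tensor_product_def)
  note vs = bilinear_map_vector_spaces[OF bl]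
  interpret T3: vector_space sT3 by (rule vs)
  interpret T33: vector_space_pair sT3 sT3 ..
  have idV: "Vector_Spaces.linear sV sV id"
    using assms(1) by (simp add: Vector_Spaces.linear_iff)
  define L where "L = tensor_map sT3 l id \<Phi>"
  define R where "R = tensor_map sT3 r \<Phi> id"
  define F where "F = tensor_map sT3 l id (tensor_flip sT2 t)"
  note mL = tensor_map[OF Tl idV assms(6), folded L_def]
  note mR = tensor_map[OF Tr assms(6) idV, folded R_def]
  note mF = tensor_map[OF Tl idV tensor_flip(1)[OF T2], folded F_def]
  have l_add: "l a (x + y) = l a x + l a y" for a x y by (rule bilinear_mapD(1)[OF bl])
  have r_add: "r (x + y) a = r x a + r y a" for a x y by (rule bilinear_mapD(3)[OF br])
  have zero: "l a 0 = 0" "r 0 a = 0" for a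
    using l_add[of a 0 0] r_add[of 0 0 a] by simp_all
  have L: "L (l a x) = l a (\<Phi> x)" for a x by (simp add: mL(2))
  \<comment> \<open>Words are kept in the form \<open>l a (t b c)\<close>. As \<open>R\<close> acts
    on the first two letters, the word is first regrouped through \<open>r\<close>.\<close>
  have R: "R (l a (t b c)) = r (\<Phi> (t a b)) c" for a b c by (simp add: mR(2) flip: r)
  have F: "F (l a (t b c)) = l a (t c b)" for a b c by (simp add: mF(2) tensor_flip(2)[OF T2])
  have add: "L (x + y) = L x + L y" "R (x + y) = R x + R y" "F (x + y) = F x + F y"
    "L 0 = 0" "R 0 = 0" "F 0 = 0" for x y
    using mL(1) mR(1) mF(1)
    by (simp_all add: T33.linear_add T33.linear_0)
  have lin: "Vector_Spaces.linear sT3 sT3 (L \<circ> R \<circ> L)" "Vector_Spaces.linear sT3 sT3 (R \<circ> F \<circ> R)"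
    using mL(1) mR(1) mF(1) by (auto intro!: Vector_Spaces.linear_compose)
  \<comment> \<open>The longest case is \<open>l e1 (t e1 e1)\<close>: both sides are the sum of the
    four words starting with \<open>e1\<close>, produced in different orders, hence
    \<open>add_ac\<close>.\<close>
  have words: "\<forall>a\<in>{e1, e2}. \<forall>b\<in>{e1, e2}. \<forall>c\<in>{e1, e2}.
      (L \<circ> R \<circ> L) (l a (t b c)) = (R \<circ> F \<circ> R) (l a (t b c))"
    by (simp add: L R F add zero l_add r_add r assms(7-10) add_ac)
  have "(L \<circ> R \<circ> L) x = (R \<circ> F \<circ> R) x" for x
  proof (rule T33.linear_eq_on[OF lin])
    \<comment> \<open>The inner use of the spanning lemma treats the last two factors, the outer one
      the product of \<open>e1\<close>, \<open>e2\<close> with the words so obtained.\<close>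
    show "x \<in> T3.span {l v w |v w. v \<in> {e1, e2} \<and>
        w \<in> {t v w |v w. v \<in> {e1, e2} \<and> w \<in> {e1, e2}}}"
      using tensor_product_span_generators[OF Tl assms(5)
          tensor_product_span_generators[OF T2 assms(5) assms(5)]] by blast
  qed (use words in blast)
  then show "lEAS sT2 sT3 t l r \<Phi>"
    using assms(6) unfolding lEAS_def L_def R_def F_def by blast
next
  fix sA :: "'k \<Rightarrow> 'a \<Rightarrow> 'a" and m
  assume A: "opposite_assoc_algebra sV sT2 t \<Phi> sA m"
  have T2: "tensor_product sV sV sT2 t"
    using assms(2) by (simp add: tensor_powers_def)
  have m: "bilinear_map sA sA sA (m a)" for a
    using A by (simp add: opposite_assoc_algebra_def)
  have lin_index: "Vector_Spaces.linear sV sA (\<lambda>a. m a x y)" for x y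
    using A by (simp add: opposite_assoc_algebra_def)
  note lin_m = bilinear_mapD[OF m]
  interpret A: vector_space sA by (rule bilinear_map_vector_spaces(3)[OF m])
  have lift: "Vector_Spaces.linear sT2 sA (tensor_lift sT2 sA t (\<lambda>c d. m c x (m d y z)))"
      "tensor_lift sT2 sA t (\<lambda>c d. m c x (m d y z)) (t a b) = m a x (m b y z)" for a b x y z
    by (rule tensor_lift[OF T2 bilinear_map_opposite_product[OF m lin_index]])+
  have lift_add: "tensor_lift sT2 sA t (\<lambda>c d. m c x (m d y z)) (p + q) =
      tensor_lift sT2 sA t (\<lambda>c d. m c x (m d y z)) p + tensor_lift sT2 sA t (\<lambda>c d. m c x (m d y z)) q"
    for x y z p q
    using lift(1) by (simp add: Vector_Spaces.linear_iff)
  have lift_0: "tensor_lift sT2 sA t (\<lambda>c d. m c x (m d y z)) 0 = 0" for x y z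
    using lift_add[of x y z 0 0] by simp
  \<comment> \<open>Oriented so that rewriting removes left-nested products. The outer index comes
    first in \<open>t a b\<close>.\<close>
  have assoc: "m a (m b x y) z = tensor_lift sT2 sA t (\<lambda>c d. m c x (m d y z)) (\<Phi> (t a b))"
    for a b x y z
    using A by (simp add: opposite_assoc_algebra_def)
  have m11: "m e1 (m e1 x y) z = m e1 x (m e1 y z) + m e1 x (m e2 y z)"
    and m12: "m e1 (m e2 x y) z = m e2 x (m e1 y z)"
    and m21: "m e2 (m e1 x y) z = 0"
    and m22: "m e2 (m e2 x y) z = m e2 x (m e2 y z)" for x y z
    by (simp_all add: assoc assms(7-10) lift lift_add lift_0)
  \<comment> \<open>Additivity applied to \<open>(y - z) + z\<close> and
    \<open>(x - y) + y\<close>.\<close>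
  have diff: "m a x (y - z) = m a x y - m a x z" "m a (x - y) z = m a x z - m a y z" for a x y z
    using lin_m(1)[of a x "y - z" z] lin_m(3)[of a "x - y" y z] by (simp_all add: eq_diff_eq)
  have "bilinear_map sA sA sA (\<lambda>x y. m e2 x y - m e2 y x)"
    by (intro bilinear_mapI A.vector_space_axioms)
      (simp_all add: lin_m A.scale_right_diff_distrib)
  \<comment> \<open>In the Jacobi sum, \<open>m22\<close> makes all twelve terms right-nested. Each
    of the six orders of \<open>x\<close>, \<open>y\<close>, \<open>z\<close> then occurs twice,
    with opposite signs.\<close>
  then have "lie_algebra sA (\<lambda>x y. m e2 x y - m e2 y x)"
    by (simp add: lie_algebra_def diff m22)
  then show "post_lie_algebra sA (\<lambda>x y. m e1 x y) (\<lambda>x y. m e2 x y - m e2 y x)"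
    using m by (simp add: post_lie_algebra_def diff m11 m12 m21)
qed

end
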